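(* Let $T$ be a one-ended tree (a tree containing a ray but no double ray) and let $m$ be an infinite cardinal. If $T$ has motion $m$ and $\Delta(T)\le 2^m$, then $a(T)=2^{|T|}$.
   Context: A ray is a one-way infinite path, a double ray a two-way infinite path. $\Delta(T)$ is the least upper bound of the vertex degrees of $T$. The motion of a graph is the least number of vertices moved by a non-identity automorphism; by convention an asymmetric graph has motion larger than every cardinal. A set $S\subseteq V(T)$ is asymmetrizing if the identity is the only automorphism of $T$ mapping $S$ onto itself; two asymmetrizing sets $S,S'$ are equivalent if some automorphism $\varphi$ of $T$ has $\varphi(S)=S'$; $a(T)$ is the number of pairwise inequivalent asymmetrizing sets of $T$. *)

theory Defs
  imports Main
begin

unbundle cardinal_syntax

text \<open>
  A graph is given by a vertex set \<open>V\<close> and a set \<open>E\<close> of two-element edges. Infinite cardinals are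
  represented by cardinal orders as in \<^theory>\<open>HOL.BNF_Cardinal_Order_Relation\<close>.
\<close>

definition simple_graph :: "'a set \<Rightarrow> 'a set set \<Rightarrow> bool" where
  "simple_graph V E \<longleftrightarrow> (\<forall>e\<in>E. \<exists>u\<in>V. \<exists>v\<in>V. u \<noteq> v \<and> e = {u, v})"

definition connected_graph :: "'a set \<Rightarrow> 'a set set \<Rightarrow> bool" where
  "connected_graph V E \<longleftrightarrow> (\<forall>u\<in>V. \<forall>v\<in>V. (u, v) \<in> {(x, y). {x, y} \<in> E}\<^sup>*)"

definition cycle :: "'a set set \<Rightarrow> 'a list \<Rightarrow> bool" where
  "cycle E xs \<longleftrightarrow> length xs \<ge> 3 \<and> distinct xs \<and>
     successively (\<lambda>u v. {u, v} \<in> E) xs \<and> {last xs, hd xs} \<in> E"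

definition tree :: "'a set \<Rightarrow> 'a set set \<Rightarrow> bool" where
  "tree V E \<longleftrightarrow> simple_graph V E \<and> V \<noteq> {} \<and> connected_graph V E \<and> (\<nexists>xs. cycle E xs)"

definition ray :: "'a set set \<Rightarrow> (nat \<Rightarrow> 'a) \<Rightarrow> bool" where
  "ray E f \<longleftrightarrow> inj f \<and> (\<forall>n. {f n, f (n + 1)} \<in> E)"

definition double_ray :: "'a set set \<Rightarrow> (int \<Rightarrow> 'a) \<Rightarrow> bool" where
  "double_ray E f \<longleftrightarrow> inj f \<and> (\<forall>n. {f n, f (n + 1)} \<in> E)"

definition one_ended_tree :: "'a set \<Rightarrow> 'a set set \<Rightarrow> bool" where
  "one_ended_tree V E \<longleftrightarrow> tree V E \<and> (\<exists>f. ray E f) \<and> (\<nexists>f. double_ray E f)"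

definition degree :: "'a set set \<Rightarrow> 'a \<Rightarrow> 'a rel" where
  "degree E v = |{u. {v, u} \<in> E}|"

text \<open>
  The degrees are bounded by the cardinality of the type \<open>'a\<close>, so their least upper bound is
  attained by a cardinal order on \<open>'a\<close>. It is determined up to \<open>=o\<close>; the lemma
  \<open>max_degree_ordLeq_iff\<close> below shows that it is also least among upper bounds on other types.
\<close>

definition max_degree :: "'a set \<Rightarrow> 'a set set \<Rightarrow> 'a rel" where
  "max_degree V E = (SOME r. Card_order r \<and> (\<forall>v\<in>V. degree E v \<le>o r) \<and>
     (\<forall>s :: 'a rel. Card_order s \<longrightarrow> (\<forall>v\<in>V. degree E v \<le>o s) \<longrightarrow> r \<le>o s))"

text \<open>
  Automorphisms are total functions of which only the restriction to \<open>V\<close> matters; hence ``the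
  identity'' below always means the identity on \<open>V\<close>.
\<close>

definition automorphism :: "'a set \<Rightarrow> 'a set set \<Rightarrow> ('a \<Rightarrow> 'a) \<Rightarrow> bool" where
  "automorphism V E \<phi> \<longleftrightarrow> bij_betw \<phi> V V \<and>
     (\<forall>u\<in>V. \<forall>v\<in>V. {\<phi> u, \<phi> v} \<in> E \<longleftrightarrow> {u, v} \<in> E)"

definition moved :: "'a set \<Rightarrow> ('a \<Rightarrow> 'a) \<Rightarrow> 'a set" where
  "moved V \<phi> = {v \<in> V. \<phi> v \<noteq> v}"

text \<open>
  An asymmetric graph has motion larger than every cardinal, so \<open>has_motion V E m\<close> fails for
  every \<open>m\<close> in that case.
\<close>

definition has_motion :: "'a set \<Rightarrow> 'a set set \<Rightarrow> 'b rel \<Rightarrow> bool" where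
  "has_motion V E m \<longleftrightarrow>
     (\<exists>\<phi>. automorphism V E \<phi> \<and> moved V \<phi> \<noteq> {} \<and> |moved V \<phi>| =o m) \<and>
     (\<forall>\<phi>. automorphism V E \<phi> \<longrightarrow> moved V \<phi> \<noteq> {} \<longrightarrow> m \<le>o |moved V \<phi>| )"

definition asymmetrizing_sets :: "'a set \<Rightarrow> 'a set set \<Rightarrow> 'a set set" where
  "asymmetrizing_sets V E =
     {S. S \<subseteq> V \<and> (\<forall>\<phi>. automorphism V E \<phi> \<longrightarrow> \<phi> ` S = S \<longrightarrow> (\<forall>v\<in>V. \<phi> v = v))}"

definition equivalent_sets :: "'a set \<Rightarrow> 'a set set \<Rightarrow> 'a set rel" where
  "equivalent_sets V E =
     {(S, S'). S \<in> asymmetrizing_sets V E \<and> S' \<in> asymmetrizing_sets V E \<and>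
        (\<exists>\<phi>. automorphism V E \<phi> \<and> \<phi> ` S = S')}"

definition asymmetrizing_number :: "'a set \<Rightarrow> 'a set set \<Rightarrow> 'a set set rel" where
  "asymmetrizing_number V E = |asymmetrizing_sets V E // equivalent_sets V E|"

lemma max_degree_props:
  fixes V :: "'a set"
  shows "Card_order (max_degree V E)" (is ?A)
    and "\<forall>v\<in>V. degree E v \<le>o max_degree V E" (is ?B)
    and "\<And>s :: 'a rel. Card_order s \<Longrightarrow> \<forall>v\<in>V. degree E v \<le>o s \<Longrightarrow> max_degree V E \<le>o s"
proof -
  define U where "U = {r :: 'a rel. Card_order r \<and> (\<forall>v\<in>V. degree E v \<le>o r)}"
  have "|UNIV :: 'a set| \<in> U"
    by (auto simp: U_def degree_def card_of_Card_order intro: card_of_mono1)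
  then obtain r where r: "r \<in> U" "\<And>s. (s, r) \<in> ordLess \<Longrightarrow> s \<notin> U"
    using wfE_min[OF wf_ordLess] by metis
  have "r \<le>o s" if "s \<in> U" for s
    using r that unfolding U_def
    by (metis (no_types, lifting) mem_Collect_eq card_order_on_well_order_on not_ordLess_iff_ordLeq)
  with r(1) have "\<exists>r :: 'a rel. Card_order r \<and> (\<forall>v\<in>V. degree E v \<le>o r) \<and>
     (\<forall>s :: 'a rel. Card_order s \<longrightarrow> (\<forall>v\<in>V. degree E v \<le>o s) \<longrightarrow> r \<le>o s)"
    unfolding U_def by blast
  from someI_ex[OF this, folded max_degree_def]
  show ?A ?B "\<And>s :: 'a rel. Card_order s \<Longrightarrow> \<forall>v\<in>V. degree E v \<le>o s \<Longrightarrow> max_degree V E \<le>o s"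
    by auto
qed

lemma max_degree_ordLeq_iff:
  fixes V :: "'a set" and r :: "'b rel"
  assumes r: "Card_order r"
  shows "max_degree V E \<le>o r \<longleftrightarrow> (\<forall>v\<in>V. degree E v \<le>o r)"
proof
  assume "max_degree V E \<le>o r"
  then show "\<forall>v\<in>V. degree E v \<le>o r"
    using max_degree_props(2)[of V E] by (auto intro: ordLeq_transitive)
next
  assume bound: "\<forall>v\<in>V. degree E v \<le>o r"
  show "max_degree V E \<le>o r"
  proof (rule ccontr)
    assume "\<not> max_degree V E \<le>o r"
    then have less: "r <o max_degree V E"
      using not_ordLeq_iff_ordLess[OF card_order_on_well_order_on[OF r]
          card_order_on_well_order_on[OF max_degree_props(1)[of V E]]] by simp
    have "|Field r| \<le>o |Field (max_degree V E)|"
      by (rule card_of_mono2[OF ordLess_imp_ordLeq[OF less]])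
    then obtain f :: "'b \<Rightarrow> 'a" where "inj_on f (Field r)"
      unfolding card_of_ordLeq[symmetric] by blast
    then have "|Field r| =o |f ` Field r|"
      by (intro card_of_ordIsoI[of f] inj_on_imp_bij_betw)
    then have iso: "r =o |f ` Field r|"
      by (rule ordIso_transitive[OF ordIso_symmetric[OF card_of_Field_ordIso[OF r]]])
    have "\<forall>v\<in>V. degree E v \<le>o |f ` Field r|"
      using bound by (auto intro: ordLeq_ordIso_trans[OF _ iso])
    then have "max_degree V E \<le>o |f ` Field r|"
      by (rule max_degree_props(3)[OF card_of_Card_order])
    then have "max_degree V E \<le>o r"
      by (rule ordLeq_ordIso_trans[OF _ ordIso_symmetric[OF iso]])
    then show False
      using not_ordLess_ordLeq[OF less] by simp
  qed
qed

lemma equiv_equivalent_sets: "equiv (asymmetrizing_sets V E) (equivalent_sets V E)"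
proof (rule equivI)
  show "equivalent_sets V E \<subseteq> asymmetrizing_sets V E \<times> asymmetrizing_sets V E"
    by (auto simp: equivalent_sets_def)
  have "automorphism V E id"
    by (simp add: automorphism_def)
  then show "refl_on (asymmetrizing_sets V E) (equivalent_sets V E)"
    by (auto simp: refl_on_def equivalent_sets_def intro!: exI[of _ id])
  show "sym (equivalent_sets V E)"
  proof (rule symI)
    fix S S' assume "(S, S') \<in> equivalent_sets V E"
    then obtain \<phi> where S: "S \<in> asymmetrizing_sets V E" "S' \<in> asymmetrizing_sets V E"
      and \<phi>: "bij_betw \<phi> V V" "\<phi> ` S = S'"
        "\<forall>u\<in>V. \<forall>v\<in>V. {\<phi> u, \<phi> v} \<in> E \<longleftrightarrow> {u, v} \<in> E"
      by (auto simp: equivalent_sets_def automorphism_def)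
    let ?\<psi> = "inv_into V \<phi>"
    have b: "bij_betw ?\<psi> V V"
      using \<phi>(1) by (rule bij_betw_inv_into)
    have "automorphism V E ?\<psi>"
      unfolding automorphism_def
    proof (intro conjI ballI b)
      fix u v assume uv: "u \<in> V" "v \<in> V"
      then have "?\<psi> u \<in> V" "?\<psi> v \<in> V"
        using b bij_betwE by blast+
      with \<phi>(3) have "{\<phi> (?\<psi> u), \<phi> (?\<psi> v)} \<in> E \<longleftrightarrow> {?\<psi> u, ?\<psi> v} \<in> E"
        by blast
      then show "{?\<psi> u, ?\<psi> v} \<in> E \<longleftrightarrow> {u, v} \<in> E"
        using uv by (simp add: bij_betw_inv_into_right[OF \<phi>(1)])
    qed
    moreover have "S \<subseteq> V"
      using S by (simp add: asymmetrizing_sets_def)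
    then have "?\<psi> ` S' = S"
      using \<phi>(1,2) by (metis bij_betw_def inv_into_image_cancel)
    ultimately show "(S', S) \<in> equivalent_sets V E"
      using S by (auto simp: equivalent_sets_def)
  qed
  show "trans (equivalent_sets V E)"
  proof (rule transI)
    fix S S' S'' assume "(S, S') \<in> equivalent_sets V E" "(S', S'') \<in> equivalent_sets V E"
    then obtain \<phi> \<psi> where S: "S \<in> asymmetrizing_sets V E" "S'' \<in> asymmetrizing_sets V E"
      and a: "automorphism V E \<phi>" "automorphism V E \<psi>" and im: "\<phi> ` S = S'" "\<psi> ` S' = S''"
      by (auto simp: equivalent_sets_def)
    have "bij_betw (\<psi> \<circ> \<phi>) V V"
      using a by (auto simp: automorphism_def intro: bij_betw_trans)
    then have "automorphism V E (\<psi> \<circ> \<phi>)"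
      using a bij_betwE unfolding automorphism_def comp_apply by blast
    moreover have "(\<psi> \<circ> \<phi>) ` S = S''"
      using im by auto
    ultimately show "(S, S'') \<in> equivalent_sets V E"
      using S unfolding equivalent_sets_def by blast
  qed
qed

end

theory Submission
  imports Defs
begin

text \<open>
  Orient the tree towards its end: every vertex \<open>v\<close> has a parent \<open>p v\<close>, the next vertex on the unique
  ray from \<open>v\<close>, and automorphisms commute with \<open>p\<close>. Since there is no double ray, the child relation
  is well-founded, so the branch below \<open>v\<close> can be coloured by recursion. If two siblings have isomorphic
  branches, swapping these is an automorphism, so the branches are infinite of size at least \<open>m\<close>, and
  there are at most \<open>2\<^sup>m\<close> siblings, hence no more of them than colourings of one branch. This leaves room
  to encode the subsets of all these branches injectively by pairwise non-isomorphic rigid colourings.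
  Along a fixed ray, all vertices stay uncoloured while each offshoot isomorphic to the branch
  of its sibling on the ray has a coloured root. A colour-preserving isomorphism fixes a tail of the
  ray and then, descending, the whole ray; so the offshoots can be coloured independently.
\<close>

section \<open>Branches of a well-founded forest\<close>

lemma card_of_Pow_mono:
  assumes "|A| \<le>o |B|" shows "|Pow A| \<le>o |Pow B|"
proof -
  obtain f where "inj_on f A" "f ` A \<subseteq> B"
    using assms unfolding card_of_ordLeq[symmetric] by blast
  then have "inj_on (image f) (Pow A)" "image f ` Pow A \<subseteq> Pow B"
    by (auto intro: inj_on_image_Pow)
  then show ?thesis unfolding card_of_ordLeq[symmetric] by blast
qed

lemma card_of_Un_absorb:
  assumes "infinite A" "|B| \<le>o |A|" shows "|A \<union> B| \<le>o |A|"
  using assms by (intro Un_Cinfinite_bound)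
    (simp_all add: cinfinite_def Field_card_of card_of_card_order_on ordLeq_refl)

text \<open>Children are the smaller elements: a chain of children must end, while \<open>p\<close>
  can be iterated forever inside \<open>V\<close>, so there is no topmost vertex. Induction and
  recursion lead from the children of a vertex to the vertex.\<close>

locale wf_parent =
  fixes V :: "'a set" and p :: "'a \<Rightarrow> 'a"
  assumes p_in: "v \<in> V \<Longrightarrow> p v \<in> V"
    and wf_child: "wf {(u, p u) |u. u \<in> V}"
begin

lemma funpow_p_in: "v \<in> V \<Longrightarrow> (p ^^ n) v \<in> V"
  by (induction n) (auto intro: p_in)

lemma funpow_p_trancl: "u \<in> V \<Longrightarrow> (u, (p ^^ Suc n) u) \<in> {(u, p u) |u. u \<in> V}\<^sup>+"
proof (induction n)
  case (Suc n)
  then have "((p ^^ Suc n) u, (p ^^ Suc (Suc n)) u) \<in> {(u, p u) |u. u \<in> V}"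
    using funpow_p_in[of u "Suc n"] by auto
  with Suc show ?case by (meson trancl.trancl_into_trancl)
qed auto

lemma funpow_p_neq:
  assumes "u \<in> V" "n > 0" shows "(p ^^ n) u \<noteq> u"
proof
  assume "(p ^^ n) u = u"
  moreover obtain k where "n = Suc k" using assms(2) gr0_conv_Suc by auto
  ultimately have "(u, u) \<in> {(u, p u) |u. u \<in> V}\<^sup>+"
    using funpow_p_trancl[OF assms(1), of k] by auto
  then show False using wf_trancl[OF wf_child] by auto
qed

lemma p_neq: "u \<in> V \<Longrightarrow> p u \<noteq> u"
  using funpow_p_neq[of u 1] by auto

section \<open>Branches and the order of their vertices\<close>

definition desc :: "'a \<Rightarrow> 'a set" where
  "desc v = {u \<in> V. \<exists>n. (p ^^ n) u = v}"

lemma desc_subset: "desc v \<subseteq> V"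
  by (auto simp: desc_def)

lemma desc_self: "v \<in> V \<Longrightarrow> v \<in> desc v"
  by (auto simp: desc_def intro: exI[of _ 0])

lemma p_in_desc: "u \<in> desc v \<Longrightarrow> u \<noteq> v \<Longrightarrow> p u \<in> desc v"
  unfolding desc_def using p_in
  by (auto, metis funpow.simps(1) id_apply funpow_simps_right(2) comp_apply not0_implies_Suc)

lemma in_desc_p: "u \<in> V \<Longrightarrow> p u \<in> desc v \<Longrightarrow> u \<in> desc v"
  unfolding desc_def by (auto, metis funpow_simps_right(2) comp_apply)

lemma child_in_desc: "y \<in> V \<Longrightarrow> p y = v \<Longrightarrow> y \<in> desc v"
  by (metis desc_self in_desc_p p_in)

lemma desc_trans: "u \<in> desc v \<Longrightarrow> v \<in> desc w \<Longrightarrow> u \<in> desc w"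
  unfolding desc_def by (auto, metis funpow_add comp_apply)

lemma desc_antisym: "u \<in> desc v \<Longrightarrow> v \<in> desc u \<Longrightarrow> u = v"
proof (rule ccontr)
  assume uv: "u \<in> desc v" "v \<in> desc u" and neq: "u \<noteq> v"
  then obtain i j where ij: "(p ^^ i) u = v" "(p ^^ j) v = u" "u \<in> V" by (auto simp: desc_def)
  then have "(p ^^ (j + i)) u = u" by (simp add: funpow_add)
  moreover have "j + i > 0" using ij(1) neq by (cases i) auto
  ultimately show False using funpow_p_neq[OF ij(3)] by simp
qed

lemma p_notin_desc: "v \<in> V \<Longrightarrow> p v \<notin> desc v"
  using desc_antisym[of "p v" v] child_in_desc[of v "p v"] p_neq by auto

lemma desc_child:
  assumes "u \<in> desc v" "u \<noteq> v"
  shows "\<exists>y. y \<in> V \<and> p y = v \<and> u \<in> desc y"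
proof -
  obtain n where n: "(p ^^ n) u = v" and u: "u \<in> V" using assms(1) by (auto simp: desc_def)
  then obtain k where "n = Suc k" using assms(2) by (cases n) auto
  then have "p ((p ^^ k) u) = v" using n by simp
  then show ?thesis using u funpow_p_in[OF u, of k] by (auto simp: desc_def)
qed

text \<open>All ancestors of \<open>u\<close> lie on its single orbit under \<open>p\<close>, so of
  any two the later one is reached from the earlier one.\<close>

lemma desc_chain:
  assumes "u \<in> desc y" "u \<in> desc z"
  shows "y \<in> desc z \<or> z \<in> desc y"
proof -
  obtain i j where ij: "(p ^^ i) u = y" "(p ^^ j) u = z" and u: "u \<in> V"
    using assms by (auto simp: desc_def)
  have "(p ^^ (j - i)) y = z" if "i \<le> j"
    using ij that by (metis comp_apply funpow_add le_add_diff_inverse2)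
  moreover have "(p ^^ (i - j)) z = y" if "j \<le> i"
    using ij that by (metis comp_apply funpow_add le_add_diff_inverse2)
  ultimately show ?thesis
    using ij u funpow_p_in[OF u] unfolding desc_def by (smt (verit) mem_Collect_eq nle_le)
qed

text \<open>With a common descendant, one sibling would lie below the other by
  \<open>desc_chain\<close>. Then the common parent would lie below one of its own children.\<close>

lemma siblings_disjoint:
  assumes "y \<in> V" "z \<in> V" "p y = p z" "y \<noteq> z"
  shows "desc y \<inter> desc z = {}"
proof -
  have "y \<notin> desc z" if "y \<in> V" "z \<in> V" "p y = p z" "y \<noteq> z" for y z
    using p_in_desc[of y z] p_notin_desc[of z] that by auto
  then show ?thesis using desc_chain assms by (metis disjoint_iff)
qed

text \<open>
  Sets are read as colourings; \<open>isom f {} {} v w\<close> expresses isomorphism of the uncoloured branches.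
\<close>

definition isom :: "('a \<Rightarrow> 'a) \<Rightarrow> 'a set \<Rightarrow> 'a set \<Rightarrow> 'a \<Rightarrow> 'a \<Rightarrow> bool" where
  "isom f S T v w \<longleftrightarrow> bij_betw f (desc v) (desc w) \<and> f v = w \<and>
     (\<forall>u\<in>desc v - {v}. f (p u) = p (f u)) \<and> (\<forall>u\<in>desc v. f u \<in> T \<longleftrightarrow> u \<in> S)"

section \<open>Isomorphisms of coloured branches\<close>

lemma isom_refl: "isom id S S v v"
  by (auto simp: isom_def)

lemma isom_uncolour: "isom f S T v w \<Longrightarrow> isom f {} {} v w"
  by (auto simp: isom_def)

text \<open>This carries a colouring over along an uncoloured isomorphism; it moves codes from one
  chosen branch to the isomorphic branches of its siblings.\<close>

lemma isom_image:
  assumes "isom f {} {} v w" "S \<subseteq> desc v"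
  shows "isom f S (f ` S) v w" "f ` S \<subseteq> desc w"
proof -
  have "inj_on f (desc v)" "f ` desc v = desc w" using assms by (auto simp: isom_def bij_betw_def)
  then show "isom f S (f ` S) v w" "f ` S \<subseteq> desc w"
    using assms unfolding isom_def by (auto simp: inj_on_image_mem_iff)
qed

lemma isom_inverse:
  assumes f: "isom f S T v w" and v: "v \<in> V"
  shows "isom (inv_into (desc v) f) T S w v"
proof -
  have bij: "bij_betw f (desc v) (desc w)" and fv: "f v = w"
    and comm: "\<And>u. u \<in> desc v \<Longrightarrow> u \<noteq> v \<Longrightarrow> f (p u) = p (f u)"
    and col: "\<And>u. u \<in> desc v \<Longrightarrow> f u \<in> T \<longleftrightarrow> u \<in> S"
    using f by (auto simp: isom_def)
  let ?g = "inv_into (desc v) f"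
  have left: "?g (f u) = u" if "u \<in> desc v" for u
    using bij that by (rule bij_betw_inv_into_left)
  have im: "desc w = f ` desc v" using bij by (simp add: bij_betw_def)
  show ?thesis
    unfolding isom_def
  proof (intro conjI ballI)
    show "bij_betw ?g (desc w) (desc v)" using bij by (rule bij_betw_inv_into)
    show "?g w = v" using left[of v] desc_self[OF v] fv by auto
  next
    fix u assume "u \<in> desc w - {w}"
    then obtain x where "x \<in> desc v" "u = f x" "x \<noteq> v" using im fv by auto
    then show "?g (p u) = p (?g u)"
      using left comm p_in_desc by (metis (no_types))
  next
    fix u assume "u \<in> desc w"
    then show "?g u \<in> S \<longleftrightarrow> u \<in> T" using im left col by auto
  qed
qed

lemma isom_trans:
  assumes "isom f S T u v" "isom g T U v w" "u \<in> V"
  shows "isom (g \<circ> f) S U u w"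
proof -
  have bij: "bij_betw f (desc u) (desc v)" and fu: "f u = v" using assms by (auto simp: isom_def)
  have "f x \<in> desc v" "f x = v \<longleftrightarrow> x = u" if "x \<in> desc u" for x
    using that bij fu desc_self[OF assms(3)] by (auto simp: bij_betw_def inj_on_def)
  then show ?thesis
    using assms(1,2) bij_betw_trans[of f "desc u" "desc v" g "desc w"] unfolding isom_def by auto
qed

lemma isom_desc_into:
  assumes "isom f S T v w" "u \<in> desc v" "x \<in> desc u"
  shows "f x \<in> desc (f u)"
proof -
  obtain n where n: "(p ^^ n) x = u" using assms(3) by (auto simp: desc_def)
  have "x \<in> desc v" using assms desc_trans by blast
  with n show ?thesis
  proof (induction n arbitrary: x)
    case 0
    then have "f x \<in> desc w" using assms(1) by (auto simp: isom_def bij_betw_def)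
    with 0 show ?case using desc_self desc_subset by auto
  next
    case (Suc n)
    have xV: "x \<in> V" using Suc.prems desc_subset by auto
    \<comment> \<open>\<open>isom\<close> lets \<open>f\<close> commute with \<open>p\<close> only
      away from the root \<open>v\<close>. If \<open>x\<close> were \<open>v\<close>, then
      \<open>u\<close> would lie both above and below \<open>v\<close>, hence equal it, and a
      positive power of \<open>p\<close> would fix \<open>v\<close>.\<close>
    have "x \<noteq> v"
    proof
      assume "x = v"
      then have "(p ^^ Suc n) v = u" "v \<in> V" using Suc.prems(1) xV by auto
      then have "v \<in> desc u" unfolding desc_def by blast
      then have "u = v" using assms(2) desc_antisym by blast
      with funpow_p_neq[of v "Suc n"] \<open>(p ^^ Suc n) v = u\<close> \<open>v \<in> V\<close> show False by auto
    qed
    then have "p x \<in> desc v" "f (p x) = p (f x)"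
      using Suc.prems p_in_desc assms(1) by (auto simp: isom_def)
    moreover have "(p ^^ n) (p x) = u" using Suc.prems(1) by (simp add: funpow_swap1)
    ultimately have "p (f x) \<in> desc (f u)" using Suc.IH[of "p x"] by metis
    moreover have "f x \<in> V"
      using Suc.prems assms(1) desc_subset by (auto simp: isom_def bij_betw_def)
    ultimately show ?case by (rule in_desc_p[rotated])
  qed
qed

text \<open>The inclusion \<open>isom_desc_into\<close>, applied to \<open>f\<close> and to its
  inverse, shows that \<open>f\<close> maps the branch below \<open>u\<close> onto the branch below
  \<open>f u\<close>.\<close>

lemma isom_restrict:
  assumes f: "isom f S T v w" and u: "u \<in> desc v" and v: "v \<in> V"
  shows "isom f S T u (f u)"
proof -
  have bij: "bij_betw f (desc v) (desc w)" using f by (auto simp: isom_def)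
  let ?g = "inv_into (desc v) f"
  have sub: "desc u \<subseteq> desc v" using u desc_trans by auto
  have "f ` desc u = desc (f u)"
  proof
    show "f ` desc u \<subseteq> desc (f u)" using isom_desc_into[OF f u] by auto
    show "desc (f u) \<subseteq> f ` desc u"
    proof
      fix x assume x: "x \<in> desc (f u)"
      have fu: "f u \<in> desc w" using bij u by (auto simp: bij_betw_def)
      then have "x \<in> desc w" using x desc_trans by blast
      moreover have "?g x \<in> desc (?g (f u))"
        using isom_desc_into[OF isom_inverse[OF f v] fu x] .
      then have "?g x \<in> desc u" using bij u by (simp add: bij_betw_inv_into_left)
      ultimately show "x \<in> f ` desc u" using bij by (metis bij_betw_inv_into_right imageI)
    qed
  qed
  then have "bij_betw f (desc u) (desc (f u))"
    using bij sub by (blast intro: bij_betw_subset)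
  moreover have "x \<noteq> v" if "x \<in> desc u - {u}" for x
    using that u desc_antisym by auto
  ultimately show ?thesis using f sub unfolding isom_def by blast
qed

lemma isom_child:
  assumes f: "isom f S T v w" and y: "y \<in> V" "p y = v" and v: "v \<in> V"
  shows "f y \<in> V" "p (f y) = w" "isom f S T y (f y)"
proof -
  have yD: "y \<in> desc v" "y \<noteq> v" using y child_in_desc p_neq by metis+
  show "isom f S T y (f y)" using isom_restrict[OF f yD(1) v] .
  show "f y \<in> V" using f yD desc_subset by (auto simp: isom_def bij_betw_def)
  show "p (f y) = w" using f yD y unfolding isom_def by fastforce
qed

text \<open>Only the traces of the colourings on the two branches count, so a global colouring may
  be replaced by the local code of a branch.\<close>

lemma isom_cong:
  assumes "isom f S T v w" "\<And>u. u \<in> desc v \<Longrightarrow> u \<in> S \<longleftrightarrow> u \<in> S'"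
    "\<And>u. u \<in> desc w \<Longrightarrow> u \<in> T \<longleftrightarrow> u \<in> T'"
  shows "isom f S' T' v w"
proof -
  have "f u \<in> desc w" if "u \<in> desc v" for u using that assms(1) by (auto simp: isom_def bij_betw_def)
  then show ?thesis using assms unfolding isom_def by simp
qed

text \<open>Apply \<open>f\<close> on the branch of \<open>y\<close>, its inverse on that of
  \<open>z\<close>, and the identity elsewhere; this is an involution. At \<open>y\<close> and
  \<open>z\<close>, where \<open>isom\<close> gives no commutation, it holds because their common
  parent lies in neither branch and is therefore fixed.\<close>

lemma swap_siblings:
  assumes y: "y \<in> V" "z \<in> V" "p y = p z" "y \<noteq> z" and f: "isom f {} {} y z"
  shows "\<exists>\<phi>. bij_betw \<phi> V V \<and> (\<forall>u\<in>V. \<phi> (p u) = p (\<phi> u)) \<and> \<phi> y = z \<and> {u \<in> V. \<phi> u \<noteq> u} \<subseteq> desc y \<union> desc z"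
proof -
  define g where "g = inv_into (desc y) f"
  define \<phi> where "\<phi> u = (if u \<in> desc y then f u else if u \<in> desc z then g u else u)" for u
  have g: "isom g {} {} z y" unfolding g_def using isom_inverse[OF f y(1)] .
  have bij: "bij_betw f (desc y) (desc z)" using f by (auto simp: isom_def)
  have disj: "desc y \<inter> desc z = {}" using siblings_disjoint[OF y] .
  have fD: "f u \<in> desc z" "g (f u) = u" if "u \<in> desc y" for u
    using that bij by (auto simp: g_def bij_betw_def)
  have gD: "g u \<in> desc y" "f (g u) = u" if "u \<in> desc z" for u
    using that bij by (auto simp: g_def bij_betw_def inv_into_into f_inv_into_f)
  have inV: "\<phi> u \<in> V" if "u \<in> V" for u
    using that fD(1) gD(1) desc_subset[of y] desc_subset[of z] by (auto simp: \<phi>_def)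
  have inv: "\<phi> (\<phi> u) = u" for u
    using fD gD disj by (auto simp: \<phi>_def)
  have "bij_betw \<phi> V V"
    by (rule bij_betw_byWitness[of _ \<phi>]) (auto simp: inv inV)
  moreover have "\<phi> (p u) = p (\<phi> u)" if u: "u \<in> V" for u
  proof -
    have *: "p y \<notin> desc y" "p y \<notin> desc z" "p z \<notin> desc y" "p z \<notin> desc z"
      using p_notin_desc y by metis+
    consider "u = y" | "u = z" | "u \<in> desc y" "u \<noteq> y" | "u \<in> desc z" "u \<noteq> z" | "u \<notin> desc y" "u \<notin> desc z"
      by blast
    then show ?thesis
    proof cases
      case 1
      have "f y = z" using f by (simp add: isom_def)
      then show ?thesis using 1 * y desc_self by (auto simp: \<phi>_def)
    next
      case 2
      have "g z = y" using g by (simp add: isom_def)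
      moreover have "z \<notin> desc y" using desc_self[OF y(2)] disj by auto
      ultimately show ?thesis using 2 * y desc_self by (auto simp: \<phi>_def)
    next
      case 3
      then show ?thesis using p_in_desc f by (auto simp: \<phi>_def isom_def)
    next
      case 4
      then have "u \<notin> desc y" "p u \<in> desc z" "p u \<notin> desc y" using p_in_desc disj by auto
      then show ?thesis using 4 g by (auto simp: \<phi>_def isom_def)
    next
      case 5
      then have "p u \<notin> desc y" "p u \<notin> desc z" using in_desc_p u by auto
      then show ?thesis using 5 by (auto simp: \<phi>_def)
    qed
  qed
  moreover have "\<phi> y = z" using f desc_self[OF y(1)] by (auto simp: \<phi>_def isom_def)
  moreover have "{u \<in> V. \<phi> u \<noteq> u} \<subseteq> desc y \<union> desc z" by (auto simp: \<phi>_def)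
  ultimately show ?thesis by blast
qed

section \<open>Maps that commute with the parent function\<close>

lemma funpow_commute:
  assumes "\<And>u. u \<in> V \<Longrightarrow> \<phi> (p u) = p (\<phi> u)" "u \<in> V"
  shows "\<phi> ((p ^^ n) u) = (p ^^ n) (\<phi> u)"
  using assms funpow_p_in by (induction n) auto

text \<open>Infinite descent: for \<open>k > 0\<close> such a \<open>z\<close> lies strictly above
  \<phi>(z), which has the same property, so there is no minimal vertex of this kind.\<close>

lemma no_translation:
  assumes comm: "\<And>u. u \<in> V \<Longrightarrow> \<phi> (p u) = p (\<phi> u)" and V: "\<And>u. u \<in> V \<Longrightarrow> \<phi> u \<in> V"
    and z: "z \<in> V" "\<phi> ((p ^^ k) z) = z"
  shows "k = 0"
proof (rule ccontr)
  assume "k \<noteq> 0"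
  then obtain n where k: "k = Suc n" using not0_implies_Suc by blast
  let ?Q = "{z \<in> V. \<phi> ((p ^^ k) z) = z}"
  obtain w where w: "w \<in> ?Q" and min: "\<And>y. (y, w) \<in> {(u, p u) |u. u \<in> V}\<^sup>+ \<Longrightarrow> y \<notin> ?Q"
    using wfE_min[OF wf_trancl[OF wf_child], of z ?Q] z by blast
  have "(p ^^ k) (\<phi> w) = w" using w funpow_commute[of \<phi> w k, OF comm] by simp
  moreover from this have "\<phi> w \<in> ?Q" using w V by simp
  ultimately show False using min[of "\<phi> w"] funpow_p_trancl[of "\<phi> w" n] k by auto
qed

lemma automorphism_isom:
  assumes bij: "bij_betw \<phi> V V" and comm: "\<And>u. u \<in> V \<Longrightarrow> \<phi> (p u) = p (\<phi> u)"
    and col: "\<And>u. u \<in> V \<Longrightarrow> \<phi> u \<in> T \<longleftrightarrow> u \<in> S" and v: "v \<in> V"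
  shows "isom \<phi> S T v (\<phi> v)"
proof -
  have inj: "inj_on \<phi> V" and im: "\<phi> ` V = V" using bij by (auto simp: bij_betw_def)
  have "\<phi> ` desc v = desc (\<phi> v)"
  proof (intro equalityI subsetI)
    fix w assume "w \<in> \<phi> ` desc v"
    then obtain u n where "w = \<phi> u" "u \<in> V" "(p ^^ n) u = v" by (auto simp: desc_def)
    then have "(p ^^ n) w = \<phi> v" "w \<in> V" using funpow_commute[of \<phi> u n, OF comm] im by auto
    then show "w \<in> desc (\<phi> v)" unfolding desc_def by blast
  next
    fix w assume "w \<in> desc (\<phi> v)"
    then obtain n where w: "w \<in> V" "(p ^^ n) w = \<phi> v" by (auto simp: desc_def)
    then obtain u where u: "u \<in> V" "w = \<phi> u" using im by blast
    then have "\<phi> ((p ^^ n) u) = \<phi> v" using w funpow_commute[of \<phi> u n, OF comm] by simp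
    then have "(p ^^ n) u = v" using inj u(1) v funpow_p_in by (meson inj_onD)
    then show "w \<in> \<phi> ` desc v" using u unfolding desc_def by blast
  qed
  then have "bij_betw \<phi> (desc v) (desc (\<phi> v))"
    using bij desc_subset by (blast intro: bij_betw_subset)
  then show ?thesis using comm col desc_subset[of v] unfolding isom_def by blast
qed

text \<open>\<open>F\<close> encodes the subsets of a branch by colourings: the case
  \<open>A = B\<close> says that each code is rigid, the case \<open>A \<noteq> B\<close> that
  different codes are not isomorphic. The colour of the root passes through unchanged, so that it
  can be prescribed when siblings are treated together.\<close>

definition codes :: "('a set \<Rightarrow> 'a set) \<Rightarrow> 'a \<Rightarrow> bool" where
  "codes F v \<longleftrightarrow> (\<forall>A. A \<subseteq> desc v \<longrightarrow> F A \<subseteq> desc v \<and> (v \<in> F A \<longleftrightarrow> v \<in> A)) \<and>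
     (\<forall>A B f. A \<subseteq> desc v \<longrightarrow> B \<subseteq> desc v \<longrightarrow> isom f (F A) (F B) v v \<longrightarrow> A = B \<and> (\<forall>u\<in>desc v. f u = u))"

lemma
  assumes "codes F v" "A \<subseteq> desc v"
  shows codes_subset: "F A \<subseteq> desc v"
    and codes_root: "v \<in> F A \<longleftrightarrow> v \<in> A"
    and codes_isom: "B \<subseteq> desc v \<Longrightarrow> isom f (F A) (F B) v v \<Longrightarrow> A = B \<and> (\<forall>u\<in>desc v. f u = u)"
proof -
  note c = assms(1)[unfolded codes_def]
  show "F A \<subseteq> desc v"
    using conjunct1[OF c, rule_format, OF assms(2)] by (rule conjunct1)
  show "v \<in> F A \<longleftrightarrow> v \<in> A"
    using conjunct1[OF c, rule_format, OF assms(2)] by (rule conjunct2)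
  show "A = B \<and> (\<forall>u\<in>desc v. f u = u)" if "B \<subseteq> desc v" "isom f (F A) (F B) v v"
    using conjunct2[OF c] assms(2) that by presburger
qed

end

section \<open>Asymmetric colourings of branches\<close>

text \<open>This is the form in which motion and degree bound enter the coding. It restricts only
  vertices that have a sibling with an isomorphic branch.\<close>

locale thin_parent = wf_parent +
  assumes thin: "\<lbrakk>y \<in> V; z \<in> V; p y = p z; y \<noteq> z; isom f {} {} y z\<rbrakk>
    \<Longrightarrow> infinite (desc y) \<and> |{x \<in> V. p x = p y}| \<le>o |Pow (desc y)|"
begin

text \<open>
  The middle conjunct is what later distinguishes an offshoot from its sibling on the ray.
\<close>

definition sibling_codes :: "('a \<Rightarrow> 'a set \<Rightarrow> 'a set) \<Rightarrow> 'a \<Rightarrow> bool" where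
  "sibling_codes G v \<longleftrightarrow>
     (\<forall>y A. y \<in> V \<longrightarrow> p y = v \<longrightarrow> A \<subseteq> desc y \<longrightarrow> G y A \<subseteq> desc y) \<and>
     (\<forall>y z f A. y \<in> V \<longrightarrow> z \<in> V \<longrightarrow> p y = v \<longrightarrow> p z = v \<longrightarrow> y \<noteq> z \<longrightarrow> isom f {} {} y z \<longrightarrow>
        A \<subseteq> desc y \<longrightarrow> y \<in> G y A) \<and>
     (\<forall>y z f A B. y \<in> V \<longrightarrow> z \<in> V \<longrightarrow> p y = v \<longrightarrow> p z = v \<longrightarrow> A \<subseteq> desc y \<longrightarrow> B \<subseteq> desc z \<longrightarrow>
        isom f (G y A) (G z B) y z \<longrightarrow> y = z \<and> A = B \<and> (\<forall>u\<in>desc y. f u = u))"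

lemma
  assumes "sibling_codes G v" "y \<in> V" "p y = v" "A \<subseteq> desc y"
  shows sibling_codes_subset: "G y A \<subseteq> desc y"
    and sibling_codes_root: "\<lbrakk>z \<in> V; p z = v; y \<noteq> z; isom f {} {} y z\<rbrakk> \<Longrightarrow> y \<in> G y A"
    and sibling_codes_isom: "\<lbrakk>z \<in> V; p z = v; B \<subseteq> desc z; isom f (G y A) (G z B) y z\<rbrakk> \<Longrightarrow>
      y = z \<and> A = B \<and> (\<forall>u\<in>desc y. f u = u)"
proof -
  note c = assms(1)[unfolded sibling_codes_def]
  show "G y A \<subseteq> desc y" using c assms(2-4) by blast
  show "y \<in> G y A" if "z \<in> V" "p z = v" "y \<noteq> z" "isom f {} {} y z"
    using c[THEN conjunct2, THEN conjunct1, rule_format, OF assms(2) that(1) assms(3) that(2-4) assms(4)] .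
  show "y = z \<and> A = B \<and> (\<forall>u\<in>desc y. f u = u)"
    if "z \<in> V" "p z = v" "B \<subseteq> desc z" "isom f (G y A) (G z B) y z"
    using c[THEN conjunct2, THEN conjunct2, rule_format, OF assms(2) that(1) assms(3) that(2) assms(4) that(3,4)] .
qed

text \<open>In each isomorphism class of children a representative \<open>x\<close> is fixed. Every
  pair of a child \<open>y\<close> in the class and a subset of its branch is injectively turned
  into a subset of \<open>desc x\<close>, which is encoded by \<open>F x\<close> and carried over to
  \<open>y\<close>. Hence a code records the child as well as the subset, and thinness provides
  enough subsets for this.\<close>

lemma ex_sibling_codes:
  assumes F: "\<And>y. y \<in> V \<Longrightarrow> p y = v \<Longrightarrow> codes (F y) y"
  shows "\<exists>G. sibling_codes G v"
proof -
  define C where "C = {y \<in> V. p y = v}"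
  define K where "K y = {z \<in> C. \<exists>f. isom f {} {} y z}" for y
  have CV: "y \<in> V" if "y \<in> C" for y using that by (auto simp: C_def)
  have self: "y \<in> K y" if "y \<in> C" for y
    using that isom_refl by (auto simp: K_def)
  have K_eq: "K y = K z" if zy: "z \<in> K y" "y \<in> C" for y z
  proof -
    obtain f where f: "isom f {} {} y z" and z: "z \<in> C" using zy by (auto simp: K_def)
    have g: "isom (inv_into (desc y) f) {} {} z y" using isom_inverse[OF f CV[OF zy(2)]] .
    show ?thesis
      using isom_trans[OF f _ CV[OF zy(2)]] isom_trans[OF g _ CV[OF z]] unfolding K_def by blast
  qed
  \<comment> \<open>The choice depends only on the class \<open>K y\<close>, so siblings with
    isomorphic branches receive the same representative.\<close>
  define r where "r y = (SOME x. x \<in> K y)" for y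
  have r: "r y \<in> K y" "r y \<in> C" if "y \<in> C" for y
  proof -
    show "r y \<in> K y" unfolding r_def by (rule someI[of _ y]) (rule self[OF that])
    then show "r y \<in> C" by (auto simp: K_def)
  qed
  have r_eq: "r y = r z" if "z \<in> K y" "y \<in> C" for y z
    using K_eq[OF that] by (simp add: r_def)
  have Kr: "K (r y) = K y" if "y \<in> C" for y using K_eq[OF r(1)] that by simp
  have "\<exists>g. isom g {} {} (r y) y" if "y \<in> C" for y
    using self[OF that] Kr[OF that] unfolding K_def by blast
  then obtain g where g: "\<And>y. y \<in> C \<Longrightarrow> isom (g y) {} {} (r y) y" by metis
  \<comment> \<open>\<open>e\<close> is the injection of pairs into subsets of
    \<open>desc x\<close>. The last clause ensures that the root is coloured in every branch that
    has an isomorphic sibling branch.\<close>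
  define Q where "Q x e \<longleftrightarrow> inj_on e (SIGMA y:K x. Pow (desc y)) \<and>
      e ` (SIGMA y:K x. Pow (desc y)) \<subseteq> Pow (desc x) \<and>
      (K x \<noteq> {x} \<longrightarrow> (\<forall>q\<in>(SIGMA y:K x. Pow (desc y)). x \<in> e q))" for x e
  have "\<exists>e. Q x e" if x: "x \<in> C" for x
  proof (cases "K x = {x}")
    case True
    \<comment> \<open>The first component can only be \<open>x\<close>, so the subset alone
      determines the pair.\<close>
    then show ?thesis by (intro exI[of _ snd]) (auto simp: Q_def inj_on_def)
  next
    case False
    then obtain z f where z: "z \<in> C" "z \<noteq> x" "isom f {} {} x z"
      using self[OF x] unfolding K_def by blast
    have inf: "infinite (desc x)" and small: "|C| \<le>o |Pow (desc x)|"
      using thin[of x z f] z x unfolding C_def by auto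
    \<comment> \<open>Setting \<open>x\<close> aside does not reduce the size of an infinite branch.
      Inserting \<open>x\<close> is injective on \<open>?P\<close>, so the root can be put into
      every value without loss.\<close>
    let ?P = "Pow (desc x - {x})"
    have "|desc x| =o |desc x - {x}|"
      using infinite_imp_bij_betw[OF inf, of x] card_of_ordIso by blast
    then have pow: "|Pow (desc x)| \<le>o |?P|"
      by (intro card_of_Pow_mono ordIso_imp_ordLeq)
    have "|K x| \<le>o |C|" by (rule card_of_mono1) (auto simp: K_def)
    then have 1: "|K x| \<le>o |?P|" by (rule ordLeq_transitive[OF _ ordLeq_transitive[OF small pow]])
    have 2: "|Pow (desc y)| \<le>o |?P|" if y: "y \<in> K x" for y
    proof -
      obtain h where "isom h {} {} x y" using y by (auto simp: K_def)
      then have "bij_betw h (desc x) (desc y)" by (simp add: isom_def)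
      then have "|desc y| \<le>o |desc x|" by (metis bij_betw_def card_of_image)
      then show ?thesis by (rule ordLeq_transitive[OF card_of_Pow_mono pow])
    qed
    have "infinite ?P" using inf by simp
    then have "|SIGMA y:K x. Pow (desc y)| \<le>o |?P|"
      using 1 2 by (intro card_of_Sigma_ordLeq_infinite) auto
    then obtain e where e: "inj_on e (SIGMA y:K x. Pow (desc y))" "e ` (SIGMA y:K x. Pow (desc y)) \<subseteq> ?P"
      unfolding card_of_ordLeq[symmetric] by blast
    have "inj_on (insert x) ?P" by (auto simp: inj_on_def)
    then have "inj_on (insert x \<circ> e) (SIGMA y:K x. Pow (desc y))"
      using e by (meson comp_inj_on inj_on_subset)
    moreover have "x \<in> desc x" using x CV desc_self by auto
    then have "(insert x \<circ> e) ` (SIGMA y:K x. Pow (desc y)) \<subseteq> Pow (desc x)"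
      using e(2) unfolding image_subset_iff comp_apply by blast
    moreover have "\<forall>q\<in>(SIGMA y:K x. Pow (desc y)). x \<in> (insert x \<circ> e) q" by simp
    ultimately show ?thesis unfolding Q_def by blast
  qed
  then obtain e where "\<And>x. x \<in> C \<Longrightarrow> Q x (e x)" by metis
  then have e: "inj_on (e x) (SIGMA y:K x. Pow (desc y))" "e x ` (SIGMA y:K x. Pow (desc y)) \<subseteq> Pow (desc x)"
    "K x \<noteq> {x} \<Longrightarrow> q \<in> (SIGMA y:K x. Pow (desc y)) \<Longrightarrow> x \<in> e x q" if "x \<in> C" for x q
    using that unfolding Q_def by blast+
  have F_codes: "codes (F (r y)) (r y)" if "y \<in> C" for y
    using F[of "r y"] r(2)[OF that] by (simp add: C_def)
  have in_Sigma: "(y, A) \<in> (SIGMA y:K (r y). Pow (desc y))" if "y \<in> C" "A \<subseteq> desc y" for y A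
    using that self Kr by auto
  have e_im: "e (r y) (y, A) \<subseteq> desc (r y)" if "y \<in> C" "A \<subseteq> desc y" for y A
    using e(2)[OF r(2)[OF that(1)]] in_Sigma[OF that] by blast
  define H where "H y A = F (r y) (e (r y) (y, A))" for y A
  have H: "H y A \<subseteq> desc (r y)" "r y \<in> H y A \<longleftrightarrow> r y \<in> e (r y) (y, A)" if "y \<in> C" "A \<subseteq> desc y" for y A
    unfolding H_def by (rule codes_subset[OF F_codes[OF that(1)] e_im[OF that]],
        rule codes_root[OF F_codes[OF that(1)] e_im[OF that]])
  define G where "G y A = g y ` H y A" for y A
  have 1: "G y A \<subseteq> desc y" if y: "y \<in> C" "A \<subseteq> desc y" for y A
    unfolding G_def using isom_image(2)[OF g[OF y(1)] H(1)[OF y]] .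
  have 2: "y \<in> G y A"
    if yz: "y \<in> C" "z \<in> C" "y \<noteq> z" "isom f {} {} y z" and A: "A \<subseteq> desc y" for y z f A
  proof -
    have "z \<in> K y" using yz by (auto simp: K_def)
    then have "K (r y) \<noteq> {r y}" using Kr[OF yz(1)] self[OF yz(1)] yz(3) by auto
    then have "r y \<in> H y A"
      using e(3) r(2)[OF yz(1)] in_Sigma[OF yz(1) A] H(2)[OF yz(1) A] by blast
    moreover have "g y (r y) = y" using g[OF yz(1)] by (simp add: isom_def)
    ultimately show ?thesis by (force simp: G_def)
  qed
  have 3: "y = z \<and> A = B \<and> (\<forall>u\<in>desc y. f u = u)"
    if y: "y \<in> C" and z: "z \<in> C" and A: "A \<subseteq> desc y" and B: "B \<subseteq> desc z"
      and f: "isom f (G y A) (G z B) y z" for y z f A B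
  proof -
    define x where "x = r y"
    have "z \<in> K y" using z isom_uncolour[OF f] by (auto simp: K_def)
    then have rz: "r z = x" using r_eq y by (simp add: x_def)
    have x: "x \<in> C" "x \<in> V" using r(2)[OF y] CV by (auto simp: x_def)
    have gy: "isom (g y) (H y A) (G y A) x y"
      using isom_image(1)[OF g[OF y] H(1)[OF y A]] by (simp add: G_def x_def)
    have gz: "isom (g z) (H z B) (G z B) x z"
      using isom_image(1)[OF g[OF z] H(1)[OF z B]] by (simp add: G_def rz)
    let ?k = "inv_into (desc x) (g z)"
    \<comment> \<open>The round trip from \<open>x\<close> to \<open>y\<close>, by \<open>f\<close>
      to \<open>z\<close> and back to \<open>x\<close> turns \<open>f\<close> into an isomorphism
      between two codes at the same vertex, where the property of \<open>F x\<close>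
      applies.\<close>
    have h: "isom (?k \<circ> (f \<circ> g y)) (H y A) (H z B) x x"
      using isom_trans[OF isom_trans[OF gy f x(2)] isom_inverse[OF gz x(2)] x(2)] .
    have "codes (F x) x" "e x (y, A) \<subseteq> desc x" "e x (z, B) \<subseteq> desc x"
      using F_codes[OF y] e_im[OF y A] e_im[OF z B] by (simp_all add: rz x_def[symmetric])
    note codes_isom[OF this h[unfolded H_def rz x_def[symmetric]]]
    then have 1: "e x (y, A) = e x (z, B)" and 2: "\<And>u. u \<in> desc x \<Longrightarrow> ?k (f (g y u)) = u"
      by simp_all
    have eq: "(y, A) = (z, B)"
      using inj_onD[OF e(1)[OF x(1)] 1] in_Sigma[OF y A] in_Sigma[OF z B]
      by (simp add: rz x_def[symmetric])
    have gb: "bij_betw (g y) (desc x) (desc y)" using gy by (simp add: isom_def)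
    have fb: "bij_betw f (desc y) (desc y)" using f eq by (simp add: isom_def)
    \<comment> \<open>Now \<open>y = z\<close>, so the round trip is a conjugate of
      \<open>f\<close>; as it is the identity on \<open>desc x\<close>, so is \<open>f\<close> on
      \<open>desc y\<close>.\<close>
    have "f w = w" if w: "w \<in> desc y" for w
    proof -
      obtain u where u: "u \<in> desc x" "w = g y u" using gb w by (auto simp: bij_betw_def)
      have "f w \<in> desc y" using fb w by (auto simp: bij_betw_def)
      then have "g y (?k (f w)) = f w" using gb eq by (auto simp: bij_betw_inv_into_right)
      then show ?thesis using 2[OF u(1)] u(2) by simp
    qed
    then show ?thesis using eq by simp
  qed
  have C: "y \<in> C" if "y \<in> V" "p y = v" for y using that by (simp add: C_def)
  have "sibling_codes G v"
    unfolding sibling_codes_def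
  proof (rule conjI[OF _ conjI]; intro allI impI)
    show "G y A \<subseteq> desc y" if "y \<in> V" "p y = v" "A \<subseteq> desc y" for y A
      using 1[OF C that(3)] that by blast
    show "y \<in> G y A"
      if "y \<in> V" "z \<in> V" "p y = v" "p z = v" "y \<noteq> z" "isom f {} {} y z" "A \<subseteq> desc y" for y z f A
      using 2[OF C C that(5-7)] that by blast
    show "y = z \<and> A = B \<and> (\<forall>u\<in>desc y. f u = u)"
      if "y \<in> V" "z \<in> V" "p y = v" "p z = v" "A \<subseteq> desc y" "B \<subseteq> desc z" "isom f (G y A) (G z B) y z"
      for y z f A B
      using 3[OF C C that(5-7)] that by blast
  qed
  then show ?thesis by blast
qed

text \<open>Well-founded induction: the codes of the children give sibling codes, which are glued
  below \<open>v\<close>. An isomorphism from \<open>v\<close> to itself sends each child to a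
  child, and the sibling codes force it to be the identity on each of their branches.\<close>

lemma ex_codes: "v \<in> V \<Longrightarrow> \<exists>F. codes F v"
proof (induction v rule: wf_induct_rule[OF wf_child])
  case (1 v)
  then have "\<exists>F. codes F y" if "y \<in> V" "p y = v" for y
    using that by auto
  then obtain F where "\<And>y. y \<in> V \<Longrightarrow> p y = v \<Longrightarrow> codes (F y) y" by metis
  then obtain G where G: "sibling_codes G v" using ex_sibling_codes by blast
  \<comment> \<open>\<open>A\<close> is split into its trace on the root, which is kept, and its
    traces on the branches of the children, which are coded separately. For a leaf only the first
    part remains.\<close>
  define F' where "F' A = (A \<inter> {v}) \<union> (\<Union>y\<in>{y \<in> V. p y = v}. G y (A \<inter> desc y))" for A
  have sub: "G y (A \<inter> desc y) \<subseteq> desc y" if "y \<in> V" "p y = v" for y A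
    using sibling_codes_subset[OF G that, of "A \<inter> desc y"] by simp
  have v_notin: "v \<notin> desc y" if "y \<in> V" "p y = v" for y
    using p_notin_desc that by blast
  have mem: "u \<in> F' A \<longleftrightarrow> u \<in> G y (A \<inter> desc y)" if y: "y \<in> V" "p y = v" and u: "u \<in> desc y" for y u A
  proof -
    have "u \<noteq> v" using u v_notin y by blast
    moreover have "z = y" if "z \<in> V" "p z = v" "u \<in> G z (A \<inter> desc z)" for z
      using siblings_disjoint[of z y] sub[OF that(1,2)] that y u by fastforce
    ultimately show ?thesis using y unfolding F'_def by blast
  qed
  have root: "v \<in> F' A \<longleftrightarrow> v \<in> A" for A
    using v_notin sub by (fastforce simp: F'_def)
  have 1: "A = B \<and> (\<forall>u\<in>desc v. f u = u)"
    if AB: "A \<subseteq> desc v" "B \<subseteq> desc v" and f: "isom f (F' A) (F' B) v v" for A B f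
  proof -
    have fv: "f v = v" using f by (simp add: isom_def)
    then have vAB: "v \<in> A \<longleftrightarrow> v \<in> B"
      using f desc_self[OF \<open>v \<in> V\<close>] root unfolding isom_def by metis
    have child: "A \<inter> desc y = B \<inter> desc y \<and> (\<forall>u\<in>desc y. f u = u)" if y: "y \<in> V" "p y = v" for y
    proof -
      note fy = isom_child[OF f y \<open>v \<in> V\<close>]
      have "isom f (G y (A \<inter> desc y)) (G (f y) (B \<inter> desc (f y))) y (f y)"
        by (rule isom_cong[OF fy(3)]) (simp_all add: mem y fy(1,2))
      then have "y = f y \<and> A \<inter> desc y = B \<inter> desc (f y) \<and> (\<forall>u\<in>desc y. f u = u)"
        by (intro sibling_codes_isom[OF G y _ fy(1,2)]) auto
      then show ?thesis by metis
    qed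
    have "u \<in> A \<longleftrightarrow> u \<in> B" "f u = u" if "u \<in> desc v" for u
      using desc_child[OF that] child vAB fv by blast+
    then show ?thesis using AB by blast
  qed
  have 2: "F' A \<subseteq> desc v" if "A \<subseteq> desc v" for A
  proof
    fix u assume "u \<in> F' A"
    then consider "u \<in> A" | y where "y \<in> V" "p y = v" "u \<in> desc y"
      using sub by (fastforce simp: F'_def)
    then show "u \<in> desc v" using that child_in_desc desc_trans by cases blast+
  qed
  have "codes F' v"
    unfolding codes_def
    by (rule conjI; intro allI impI) ((rule conjI[OF 2 root]; assumption), (rule 1; assumption))
  then show ?case by blast
qed

end

section \<open>Gluing branches along a ray\<close>

text \<open>\<open>meet\<close> expresses connectedness through \<open>p\<close>: any two upward
  orbits merge, so all of them lead to the same end. The base point \<open>x0\<close> only serves to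
  select one of these orbits.\<close>

locale one_ended_parent = wf_parent +
  fixes x0 :: 'a
  assumes x0: "x0 \<in> V"
    and meet: "u \<in> V \<Longrightarrow> v \<in> V \<Longrightarrow> \<exists>i j. (p ^^ i) u = (p ^^ j) v"
begin

definition spine :: "nat \<Rightarrow> 'a" where "spine n = (p ^^ n) x0"

lemma spine_in: "spine n \<in> V" and p_spine: "p (spine n) = spine (Suc n)"
  using x0 funpow_p_in by (auto simp: spine_def)

lemma funpow_p_spine: "(p ^^ k) (spine n) = spine (k + n)"
  by (simp add: spine_def funpow_add)

lemma inj_spine: "inj spine"
proof -
  have "spine m \<noteq> spine n" if "m < n" for m n
    using funpow_p_neq[OF spine_in[of m], of "n - m"] that by (simp add: funpow_p_spine)
  then show ?thesis by (metis injI nat_neq_iff)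
qed

text \<open>The orbits of \<open>x0\<close> and its image merge, so some \<open>spine j\<close> is
  mapped to some \<open>spine i\<close>. If \<open>i < j\<close>, then \<phi> violates
  \<open>no_translation\<close>; if \<open>j < i\<close>, its inverse does. So \<open>i = j\<close>,
  and commutation with \<open>p\<close> fixes everything further up the spine.\<close>

lemma automorphism_fixes_tail:
  assumes bij: "bij_betw \<phi> V V" and comm: "\<And>u. u \<in> V \<Longrightarrow> \<phi> (p u) = p (\<phi> u)"
  shows "\<exists>N. \<forall>n\<ge>N. \<phi> (spine n) = spine n"
proof -
  have V: "\<phi> u \<in> V" if "u \<in> V" for u using bij that by (auto simp: bij_betw_def)
  obtain i j where "(p ^^ i) x0 = (p ^^ j) (\<phi> x0)" using meet[OF x0 V[OF x0]] by blast
  then have ij: "\<phi> (spine j) = spine i" using funpow_commute[of \<phi> x0 j, OF comm x0] by (simp add: spine_def)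
  have "j \<le> i"
  proof (rule ccontr)
    assume "\<not> j \<le> i"
    then have "\<phi> ((p ^^ (j - i)) (spine i)) = spine i" using ij by (simp add: funpow_p_spine)
    then show False using no_translation[of \<phi> "spine i" "j - i", OF comm V spine_in] \<open>\<not> j \<le> i\<close> by force
  qed
  moreover have "i \<le> j"
  proof (rule ccontr)
    assume "\<not> i \<le> j"
    define \<psi> where "\<psi> = inv_into V \<phi>"
    have left: "\<psi> (\<phi> u) = u" if "u \<in> V" for u
      using bij that by (simp add: \<psi>_def bij_betw_inv_into_left)
    have V': "\<psi> u \<in> V" "\<phi> (\<psi> u) = u" if "u \<in> V" for u
      using bij that by (auto simp: \<psi>_def bij_betw_def inv_into_into f_inv_into_f)
    have comm': "\<psi> (p u) = p (\<psi> u)" if "u \<in> V" for u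
      using comm[OF V'(1)[OF that]] V'(2)[OF that] left[OF p_in[OF V'(1)[OF that]]] by simp
    have "\<psi> ((p ^^ (i - j)) (spine j)) = spine j"
      using ij left[OF spine_in, of j] \<open>\<not> i \<le> j\<close> by (simp add: funpow_p_spine)
    then show False using no_translation[of \<psi> "spine j" "i - j", OF comm' V'(1) spine_in] \<open>\<not> i \<le> j\<close> by force
  qed
  ultimately have "\<phi> (spine i) = spine i" using ij by simp
  then have "\<phi> (spine (k + i)) = spine (k + i)" for k
    using funpow_commute[of \<phi> "spine i" k, OF comm spine_in] by (simp add: funpow_p_spine)
  then show ?thesis by (metis le_add_diff_inverse2)
qed

text \<open>These are the roots of the branches left after deleting the spine. All children of
  \<open>spine 0\<close> are among them, so the vertices below \<open>x0\<close> are covered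
  too.\<close>

definition offshoots :: "'a set" where
  "offshoots = {y \<in> V. y \<notin> range spine \<and> p y \<in> range spine}"

lemma funpow_p_range: "u \<in> range spine \<Longrightarrow> (p ^^ n) u \<in> range spine"
  using funpow_p_spine by auto

lemma offshoots_cover:
  assumes "u \<in> V" "u \<notin> range spine" shows "\<exists>y\<in>offshoots. u \<in> desc y"
proof -
  obtain i j where "(p ^^ i) u = spine j" using meet[OF assms(1) x0] by (auto simp: spine_def)
  then have ex: "(p ^^ i) u \<in> range spine" by simp
  \<comment> \<open>Climb from \<open>u\<close> to the first vertex on the spine; the vertex just
    before it is the offshoot. Since \<open>u\<close> is off the spine, at least one step is
    made.\<close>
  define n where "n = (LEAST n. (p ^^ n) u \<in> range spine)"
  have n: "(p ^^ n) u \<in> range spine" unfolding n_def by (rule LeastI[of _ i]) (rule ex)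
  then obtain k where k: "n = Suc k" using assms(2) by (cases n) auto
  then have "(p ^^ k) u \<notin> range spine" using not_less_Least[of k "\<lambda>n. (p ^^ n) u \<in> range spine", folded n_def] by simp
  then have "(p ^^ k) u \<in> offshoots" using n k assms(1) funpow_p_in by (simp add: offshoots_def)
  then show ?thesis using assms(1) by (auto simp: desc_def)
qed

lemma offshoots_disjoint_spine: "y \<in> offshoots \<Longrightarrow> desc y \<inter> range spine = {}"
  using funpow_p_range by (auto simp: offshoots_def desc_def)

lemma offshoots_disjoint:
  assumes "y \<in> offshoots" "z \<in> offshoots" "y \<noteq> z" shows "desc y \<inter> desc z = {}"
proof -
  have "y \<notin> desc z" if yz: "y \<in> offshoots" "z \<in> offshoots" "y \<noteq> z" for y z
  proof
    assume "y \<in> desc z"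
    then have "p y \<in> desc z" using p_in_desc yz by blast
    then show False using offshoots_disjoint_spine[OF yz(2)] yz(1) by (auto simp: offshoots_def)
  qed
  then show ?thesis using desc_chain assms by (metis disjoint_iff)
qed

end

locale thin_one_ended_parent = one_ended_parent + thin_parent
begin

text \<open>Sets off the spine serve as indices: the case \<open>A = B\<close> makes
  \<open>S A\<close> asymmetrizing, and the case \<open>A \<noteq> B\<close> makes
  \<open>S A\<close> and \<open>S B\<close> inequivalent.\<close>

lemma ex_asymmetrizing_codes:
  "\<exists>S. (\<forall>A. S A \<subseteq> V) \<and>
     (\<forall>A B \<phi>. A \<subseteq> V - range spine \<longrightarrow> B \<subseteq> V - range spine \<longrightarrow> bij_betw \<phi> V V \<longrightarrow>
       (\<forall>u\<in>V. \<phi> (p u) = p (\<phi> u)) \<longrightarrow> \<phi> ` S A = S B \<longrightarrow> A = B \<and> (\<forall>v\<in>V. \<phi> v = v))"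
proof -
  obtain F where "\<And>v. v \<in> V \<Longrightarrow> codes (F v) v" using ex_codes by metis
  then have "\<exists>G. sibling_codes G v" for v using ex_sibling_codes by blast
  then obtain G where G: "\<And>v. sibling_codes (G v) v" by metis
  \<comment> \<open>The sibling codes refer to all children of \<open>p y\<close>, including one on
    the spine. So an offshoot whose branch is isomorphic to that of its spine sibling gets a
    coloured root.\<close>
  define S where "S A = (\<Union>y\<in>offshoots. G (p y) y (A \<inter> desc y))" for A
  have YV: "y \<in> V" if "y \<in> offshoots" for y using that by (simp add: offshoots_def)
  have sub: "G (p y) y (A \<inter> desc y) \<subseteq> desc y" if "y \<in> offshoots" for y A
    using sibling_codes_subset[OF G YV[OF that] refl, of "A \<inter> desc y"] by simp
  have SV: "S A \<subseteq> V" for A using sub desc_subset by (fastforce simp: S_def)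
  have S_spine: "spine n \<notin> S A" for n A
    using sub offshoots_disjoint_spine by (fastforce simp: S_def)
  have mem: "u \<in> S A \<longleftrightarrow> u \<in> G (p y) y (A \<inter> desc y)" if y: "y \<in> offshoots" and u: "u \<in> desc y" for y u A
  proof -
    have "z = y" if "z \<in> offshoots" "u \<in> G (p z) z (A \<inter> desc z)" for z
      using offshoots_disjoint[of z y] sub[OF that(1)] that y u by fastforce
    then show ?thesis using y unfolding S_def by blast
  qed
  have "A = B \<and> (\<forall>v\<in>V. \<phi> v = v)"
    if A: "A \<subseteq> V - range spine" and B: "B \<subseteq> V - range spine" and bij: "bij_betw \<phi> V V"
      and comm: "\<And>u. u \<in> V \<Longrightarrow> \<phi> (p u) = p (\<phi> u)" and im: "\<phi> ` S A = S B" for A B \<phi>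
  proof -
    have inj: "inj_on \<phi> V" using bij by (simp add: bij_betw_def)
    have V: "\<phi> u \<in> V" if "u \<in> V" for u using bij that by (auto simp: bij_betw_def)
    have "\<phi> u \<in> S B \<longleftrightarrow> u \<in> S A" if "u \<in> V" for u
      using inj_on_image_mem_iff[OF inj that SV[of A]] im by simp
    then have isom: "isom \<phi> (S A) (S B) v (\<phi> v)" if "v \<in> V" for v
      using automorphism_isom[OF bij comm _ that] by blast
    have fix_step: "\<phi> (spine n) = spine n" if "\<phi> (spine (Suc n)) = spine (Suc n)" for n
    proof (rule ccontr)
      assume neq: "\<phi> (spine n) \<noteq> spine n"
      define z where "z = \<phi> (spine n)"
      have z: "z \<in> V" "p z = spine (Suc n)"
        using V spine_in comm[OF spine_in, of n] that by (simp_all add: z_def p_spine)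
      have "z \<notin> range spine"
      proof
        assume "z \<in> range spine"
        then obtain k where "z = spine k" by blast
        then show False using z(2) inj_spine neq by (simp add: p_spine inj_eq z_def)
      qed
      then have zY: "z \<in> offshoots" using z by (simp add: offshoots_def)
      note iso = isom[OF spine_in, of n, folded z_def]
      \<comment> \<open>The branch of \<open>z\<close> is isomorphic to that of its sibling
        \<open>spine n\<close>, which forces \<open>z\<close> to be coloured. But \<phi> preserves
        colours and \<open>spine n\<close> is uncoloured.\<close>
      have "z \<in> G (p z) z (B \<inter> desc z)"
        using sibling_codes_root[OF G z(1) refl _ spine_in _ _
            isom_inverse[OF isom_uncolour[OF iso] spine_in], of "B \<inter> desc z"] neq z
        by (simp add: p_spine z_def)
      then have "z \<in> S B" using mem[OF zY desc_self[OF z(1)]] by simp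
      then have "spine n \<in> S A" using iso desc_self[OF spine_in] unfolding isom_def by metis
      then show False using S_spine by blast
    qed
    obtain N where N: "\<And>n. n \<ge> N \<Longrightarrow> \<phi> (spine n) = spine n"
      using automorphism_fixes_tail[OF bij comm] by blast
    have fix_spine: "\<phi> (spine n) = spine n" for n
    proof (cases "n \<le> N")
      case True
      \<comment> \<open>Downward induction, starting in the fixed tail at \<open>N\<close>.\<close>
      then show ?thesis by (induction rule: inc_induct) (auto intro: N fix_step)
    qed (simp add: N)
    have branch: "A \<inter> desc y = B \<inter> desc y \<and> (\<forall>u\<in>desc y. \<phi> u = u)" if y: "y \<in> offshoots" for y
    proof -
      obtain n where n: "p y = spine n" using y by (auto simp: offshoots_def)
      have py: "p (\<phi> y) = p y" using comm[OF YV[OF y]] fix_spine n by simp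
      have "\<phi> y \<notin> range spine"
      proof
        assume "\<phi> y \<in> range spine"
        then obtain k where "\<phi> y = \<phi> (spine k)" using fix_spine by force
        then show False using inj y spine_in unfolding offshoots_def by (auto dest: inj_onD)
      qed
      then have \<phi>y: "\<phi> y \<in> offshoots" using y py V by (auto simp: offshoots_def)
      have "isom \<phi> (G (p y) y (A \<inter> desc y)) (G (p y) (\<phi> y) (B \<inter> desc (\<phi> y))) y (\<phi> y)"
        using isom[OF YV[OF y]] by (rule isom_cong) (simp_all add: mem[OF y] mem[OF \<phi>y] py)
      then have "y = \<phi> y \<and> A \<inter> desc y = B \<inter> desc (\<phi> y) \<and> (\<forall>u\<in>desc y. \<phi> u = u)"
        by (intro sibling_codes_isom[OF G YV[OF y] refl _ YV[OF \<phi>y] py]) auto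
      then show ?thesis by metis
    qed
    have "\<phi> u = u" if "u \<in> V" for u
      using offshoots_cover[OF that] branch fix_spine by (cases "u \<in> range spine") auto
    moreover have "u \<in> A \<longleftrightarrow> u \<in> B" if "u \<in> V" "u \<notin> range spine" for u
      using offshoots_cover[OF that] branch by blast
    ultimately show ?thesis using A B by blast
  qed
  then show ?thesis
    using SV by (intro exI[of _ S] conjI allI impI) simp_all
qed

end

section \<open>The parent function of a one-ended tree\<close>

lemma ray_shift:
  assumes "ray E g" shows "ray E (\<lambda>n. g (n + k))"
proof -
  have "{g (n + k), g (Suc (n + k))} \<in> E" for n
    using assms by (simp add: ray_def)
  moreover have "inj (\<lambda>n. g (n + k))"
    using assms by (auto simp: ray_def inj_eq intro!: injI)
  ultimately show ?thesis by (simp add: ray_def)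
qed

lemma ray_cons:
  assumes "ray E g" "z \<notin> range g" "{z, g 0} \<in> E"
  shows "ray E (case_nat z g)"
proof -
  have "inj (case_nat z g)"
    using assms(1,2) by (auto simp: ray_def inj_def split: nat.splits)
  moreover have "{case_nat z g n, case_nat z g (n + 1)} \<in> E" for n
    using assms(1,3) by (cases n) (auto simp: ray_def)
  ultimately show ?thesis by (simp add: ray_def)
qed

locale one_ended =
  fixes V :: "'a set" and E :: "'a set set"
  assumes one_ended: "one_ended_tree V E"
begin

lemma simple: "simple_graph V E" and no_cycle: "\<not> cycle E xs"
  and no_double_ray: "\<not> double_ray E d" and ex_ray: "\<exists>f. ray E f"
  and conn: "u \<in> V \<Longrightarrow> v \<in> V \<Longrightarrow> (u, v) \<in> {(x, y). {x, y} \<in> E}\<^sup>*"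
  using one_ended by (auto simp: one_ended_tree_def tree_def connected_graph_def)

lemma edge_in:
  assumes "{u, v} \<in> E" shows "u \<in> V" "v \<in> V" "u \<noteq> v"
proof -
  obtain a b where "a \<in> V" "b \<in> V" "a \<noteq> b" "{u, v} = {a, b}"
    using simple assms unfolding simple_graph_def by blast
  then show "u \<in> V" "v \<in> V" "u \<noteq> v" by (auto simp: doubleton_eq_iff)
qed

lemma ray_in: "ray E g \<Longrightarrow> g n \<in> V"
  using edge_in(1) by (auto simp: ray_def)

text \<open>Walk from a given ray to \<open>v\<close>, keeping a ray that starts at the current
  vertex: a vertex already on the ray is reached by passing to a tail, any other is
  prepended.\<close>

lemma ex_ray_from:
  assumes "v \<in> V" shows "\<exists>g. ray E g \<and> g 0 = v"
proof -
  obtain f where f: "ray E f" using ex_ray by blast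
  have "(f 0, v) \<in> {(x, y). {x, y} \<in> E}\<^sup>*" using conn ray_in[OF f] assms by blast
  then show ?thesis
  proof (induction rule: rtrancl_induct)
    case base
    then show ?case using f by blast
  next
    case (step y z)
    then obtain g where g: "ray E g" "g 0 = y" by blast
    show ?case
    proof (cases "z \<in> range g")
      case True
      then obtain k where "z = g k" by blast
      then show ?thesis using ray_shift[OF g(1), of k] by (intro exI[of _ "\<lambda>n. g (n + k)"]) simp
    next
      case False
      then have "ray E (case_nat z g)"
        using ray_cons[OF g(1)] step(2) g(2) by (simp add: insert_commute)
      then show ?thesis by (intro exI[of _ "case_nat z g"]) simp
    qed
  qed
qed

text \<open>Two rays that leave the same vertex by different edges would form a cycle if they met
  again, and a double ray otherwise.\<close>

lemma ray_next_unique: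
  assumes g: "ray E g" and h: "ray E h" and 0: "g 0 = h 0"
  shows "g 1 = h 1"
proof (rule ccontr)
  assume neq: "g 1 \<noteq> h 1"
  have gi: "g a = g b \<longleftrightarrow> a = b" and hi: "h a = h b \<longleftrightarrow> a = b" for a b
    using g h by (auto simp: ray_def inj_eq)
  have ge: "{g n, g (Suc n)} \<in> E" and he: "{h n, h (Suc n)} \<in> E" for n
    using g h by (auto simp: ray_def)
  show False
  proof (cases "\<exists>i\<ge>1. \<exists>j\<ge>1. g i = h j")
    case True
    define P where "P i \<longleftrightarrow> i \<ge> 1 \<and> (\<exists>j\<ge>1. g i = h j)" for i
    define i where "i = (LEAST i. P i)"
    have "\<exists>i. P i" using True by (auto simp: P_def)
    then have "P i" unfolding i_def by (rule LeastI_ex)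
    then obtain j where i: "i \<ge> 1" and j: "j \<ge> 1" "g i = h j" unfolding P_def by blast
    have min: "g a \<noteq> h b" if "a < i" "b \<ge> 1" for a b
      using not_less_Least[of a P, folded i_def] that 0 hi[of 0 b]
      by (cases "a = 0") (auto simp: P_def)
    \<comment> \<open>With \<open>i\<close> the first index at which \<open>g\<close> returns to
      \<open>h\<close>, the cycle follows \<open>g\<close> up to \<open>g (i - 1)\<close>, continues
      at \<open>h j = g i\<close> and returns along \<open>h\<close> to \<open>h 1\<close>, which is
      adjacent to \<open>h 0 = g 0\<close>.\<close>
    let ?xs = "map g [0..<i]" and ?ys = "map h [1..<Suc j]"
    have len: "length (?xs @ rev ?ys) \<ge> 3"
    proof -
      have "i \<noteq> 1 \<or> j \<noteq> 1" using j(2) neq by auto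
      then show ?thesis using i j(1) by auto
    qed
    have "distinct (?xs @ rev ?ys)"
      using min by (auto simp: distinct_map inj_on_def gi hi)
    moreover have "successively (\<lambda>u v. {u, v} \<in> E) ?xs"
      by (auto simp: successively_conv_nth ge)
    moreover have "successively (\<lambda>u v. {v, u} \<in> E) ?ys"
      using he by (auto simp: successively_conv_nth insert_commute simp del: upt_Suc)
    then have "successively (\<lambda>u v. {u, v} \<in> E) (rev ?ys)" by (simp only: successively_rev)
    moreover have "?xs \<noteq> []" "hd ?xs = h 0" "last ?xs = g (i - 1)"
      using i 0 by (simp_all add: hd_map last_map)
    moreover have "rev ?ys \<noteq> []" "hd (rev ?ys) = g i" "last (rev ?ys) = h 1"
      using j by (simp_all add: hd_rev last_rev hd_map last_map hd_upt last_upt del: upt_Suc)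
    moreover have "{g (i - 1), g i} \<in> E" "{h 1, h 0} \<in> E"
      using ge[of "i - 1"] he[of 0] i by (simp_all add: insert_commute)
    ultimately have "cycle E (?xs @ rev ?ys)"
      unfolding cycle_def using len by (simp only: successively_append_iff hd_append2 last_appendR not_False_eq_True simp_thms)
    then show False using no_cycle by blast
  next
    case False
    \<comment> \<open>The common start is counted once, at index \<open>0\<close>; the negative side
      begins with \<open>h 1\<close> at index \<open>-1\<close>.\<close>
    define d where "d n = (if n \<ge> 0 then g (nat n) else h (nat (- n)))" for n :: int
    have sep: "g a \<noteq> h b" if "b \<ge> 1" for a b
      using False that 0 hi[of 0 b] by (cases "a = 0") auto
    have "d a \<noteq> d b" if "a < b" for a b
    proof -
      consider "a \<ge> 0" | "a < 0" "b \<ge> 0" | "b < 0" by linarith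
      then show ?thesis
      proof cases
        case 2
        then have "1 \<le> nat (- a)" by linarith
        then show ?thesis using 2 sep[of "nat (- a)" "nat b"] by (auto simp: d_def)
      qed (use that in \<open>auto simp: d_def gi hi\<close>)
    qed
    then have "inj d" by (metis injI linorder_neqE)
    moreover have "{d n, d (n + 1)} \<in> E" for n
    proof -
      consider "n \<ge> 0" | "n = -1" | "n < -1" by linarith
      then show ?thesis
      proof cases
        case 1
        then show ?thesis using ge[of "nat n"] by (simp add: d_def nat_add_distrib)
      next
        case 2
        then show ?thesis using he[of 0] 0 by (simp add: d_def insert_commute)
      next
        case 3
        then have "nat (- n) = Suc (nat (- (n + 1)))" by linarith
        then show ?thesis using 3 he[of "nat (- (n + 1))"] by (simp add: d_def insert_commute)
      qed
    qed
    ultimately show False using no_double_ray by (auto simp: double_ray_def)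
  qed
qed

text \<open>The value is independent of the chosen ray by \<open>ray_next_unique\<close>, and every
  vertex of \<open>V\<close> starts a ray by \<open>ex_ray_from\<close>.\<close>

definition p :: "'a \<Rightarrow> 'a" where
  "p v = (SOME g. ray E g \<and> g 0 = v) 1"

lemma p_ray:
  assumes g: "ray E g" shows "p (g n) = g (Suc n)"
proof -
  let ?h = "SOME h. ray E h \<and> h 0 = g n"
  have "ray E ?h \<and> ?h 0 = g n"
    by (rule someI[of "\<lambda>h. ray E h \<and> h 0 = g n" "\<lambda>k. g (k + n)"]) (simp add: ray_shift[OF g])
  then show ?thesis
    using ray_next_unique[OF _ ray_shift[OF g, of n], of ?h] by (simp add: p_def)
qed

lemma funpow_p_ray: "ray E g \<Longrightarrow> (p ^^ n) (g 0) = g n"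
  by (induction n) (auto simp: p_ray)

lemma p_edge: assumes "v \<in> V" shows "{v, p v} \<in> E"
proof -
  obtain g where g: "ray E g" "g 0 = v" using ex_ray_from[OF assms] by blast
  then show ?thesis using p_ray[OF g(1), of 0] by (auto simp: ray_def)
qed

text \<open>Take the ray from \<open>v\<close>. If it misses \<open>u\<close>, prepending
  \<open>u\<close> gives a ray that shows \<open>p u = v\<close>. Otherwise its tail from
  \<open>u\<close> misses \<open>v\<close>, and prepending \<open>v\<close> to this tail shows
  \<open>p v = u\<close>.\<close>

lemma edge_iff: "{u, v} \<in> E \<longleftrightarrow> u \<in> V \<and> v \<in> V \<and> (p u = v \<or> p v = u)"
proof
  assume e: "{u, v} \<in> E"
  obtain g where g: "ray E g" "g 0 = v" using ex_ray_from edge_in(2)[OF e] by blast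
  have "p u = v \<or> p v = u"
  proof (cases "u \<in> range g")
    case False
    then have "ray E (case_nat u g)" using ray_cons[OF g(1)] e g(2) by simp
    from p_ray[OF this, of 0] show ?thesis using g(2) by simp
  next
    case True
    then obtain k where k: "u = g k" by blast
    then have "k \<noteq> 0" using edge_in(3)[OF e] g(2) by metis
    then have "v \<notin> range (\<lambda>n. g (n + k))" using g by (auto simp: ray_def inj_eq)
    then have "ray E (case_nat v (\<lambda>n. g (n + k)))"
      using ray_cons[OF ray_shift[OF g(1)]] e k by (simp add: insert_commute)
    from p_ray[OF this, of 0] show ?thesis using k by simp
  qed
  then show "u \<in> V \<and> v \<in> V \<and> (p u = v \<or> p v = u)" using edge_in[OF e] by blast
next
  assume "u \<in> V \<and> v \<in> V \<and> (p u = v \<or> p v = u)"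
  then show "{u, v} \<in> E" using p_edge by (metis insert_commute)
qed

lemma p_in: "v \<in> V \<Longrightarrow> p v \<in> V"
  using p_edge edge_in(2) by blast

lemma funpow_p_eq:
  assumes "v \<in> V" "(p ^^ n) v = v" shows "n = 0"
proof -
  obtain g where g: "ray E g" "g 0 = v" using ex_ray_from[OF assms(1)] by blast
  then have "g n = g 0" using funpow_p_ray[OF g(1), of n] assms(2) by simp
  then show ?thesis using g(1) by (simp add: ray_def inj_eq)
qed

text \<open>An infinite chain of children, continued upwards from its first vertex by
  \<open>p\<close>, would be a double ray; it is injective since no positive power of
  \<open>p\<close> fixes a vertex.\<close>

lemma wf_p: "wf {(u, p u) |u. u \<in> V}"
  unfolding wf_iff_no_infinite_down_chain
proof
  assume "\<exists>f. \<forall>i. (f (Suc i), f i) \<in> {(u, p u) |u. u \<in> V}"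
  then obtain f where f': "\<And>i. (f (Suc i), f i) \<in> {(u, p u) |u. u \<in> V}" by blast
  have f: "f (Suc i) \<in> V" "p (f (Suc i)) = f i" for i using f'[of i] by auto
  have fV: "f i \<in> V" for i using f[of i] p_in by metis
  define d where "d n = (if n \<ge> 0 then (p ^^ nat n) (f 0) else f (nat (- n)))" for n :: int
  have "(p ^^ k) (f 0) \<in> V" for k by (induction k) (auto intro: fV p_in)
  then have dV: "d n \<in> V" for n using fV by (simp add: d_def)
  have pd: "p (d n) = d (n + 1)" for n
  proof -
    consider "n \<ge> 0" | "n = -1" | "n < -1" by linarith
    then show ?thesis
    proof cases
      case 1
      then show ?thesis by (simp add: d_def nat_add_distrib)
    next
      case 2
      then show ?thesis using f(2)[of 0] by (simp add: d_def)
    next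
      case 3
      then have "nat (- n) = Suc (nat (- (n + 1)))" by linarith
      then show ?thesis using 3 f(2)[of "nat (- (n + 1))"] by (simp add: d_def)
    qed
  qed
  have iter: "(p ^^ k) (d n) = d (n + int k)" for k n
    by (induction k) (auto simp: pd algebra_simps)
  have neq: "d a \<noteq> d b" if "a < b" for a b
  proof
    assume "d a = d b"
    then have "(p ^^ nat (b - a)) (d a) = d a" using iter[of "nat (b - a)" a] that by simp
    then show False using funpow_p_eq[OF dV] that by fastforce
  qed
  then have "inj d" by (metis injI linorder_neqE)
  then have "double_ray E d"
    using p_edge[OF dV] pd by (simp add: double_ray_def)
  then show False using no_double_ray by blast
qed

text \<open>Induction along a path: of two adjacent vertices one is the parent of the other, so
  their upward orbits merge.\<close>

lemma p_meet:
  assumes "u \<in> V" "v \<in> V" shows "\<exists>i j. (p ^^ i) u = (p ^^ j) v"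
  using conn[OF assms]
proof (induction rule: rtrancl_induct)
  case base
  then show ?case by blast
next
  case (step y z)
  then obtain i j where ij: "(p ^^ i) u = (p ^^ j) y" by blast
  from step(2) consider "p y = z" | "p z = y" using edge_iff by auto
  then show ?case
  proof cases
    case 1
    then have "(p ^^ Suc i) u = (p ^^ j) z" using ij by (simp add: funpow_swap1)
    then show ?thesis by blast
  next
    case 2
    then have "(p ^^ i) u = (p ^^ Suc j) z" using ij by (simp add: funpow_swap1)
    then show ?thesis by blast
  qed
qed

text \<open>An automorphism maps a ray from \<open>v\<close> to a ray from the image of
  \<open>v\<close>, and \<open>p\<close> gives the second vertex of any such ray.\<close>

lemma automorphism_p:
  assumes \<phi>: "automorphism V E \<phi>" and v: "v \<in> V"
  shows "\<phi> (p v) = p (\<phi> v)"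
proof -
  obtain g where g: "ray E g" "g 0 = v" using ex_ray_from[OF v] by blast
  have "inj (\<phi> \<circ> g)"
    using \<phi> g(1) ray_in[OF g(1)] unfolding automorphism_def ray_def bij_betw_def
    by (auto simp: inj_def inj_on_def)
  moreover have "{\<phi> (g n), \<phi> (g (n + 1))} \<in> E" for n
    using \<phi> g(1) ray_in[OF g(1)] unfolding automorphism_def ray_def by blast
  ultimately have "ray E (\<phi> \<circ> g)" by (simp add: ray_def)
  from p_ray[OF this, of 0] show ?thesis using p_ray[OF g(1), of 0] g(2) by simp
qed

lemma automorphismI:
  assumes bij: "bij_betw \<phi> V V" and comm: "\<And>v. v \<in> V \<Longrightarrow> \<phi> (p v) = p (\<phi> v)"
  shows "automorphism V E \<phi>"
proof -
  have "\<phi> v \<in> V" if "v \<in> V" for v using bij that by (auto simp: bij_betw_def)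
  moreover have "\<phi> u = \<phi> v \<longleftrightarrow> u = v" if "u \<in> V" "v \<in> V" for u v
    using bij that by (auto simp: bij_betw_def inj_on_def)
  ultimately show ?thesis
    unfolding automorphism_def edge_iff using bij comm p_in by metis
qed

end

section \<open>From motion and degree to the number of asymmetrizing sets\<close>

theorem theorem3p2:
  fixes V :: "'a set" and E :: "'a set set" and m :: "'b rel"
  assumes "one_ended_tree V E"
    and "Card_order m" and "cinfinite m"
    and "has_motion V E m"
    and "max_degree V E \<le>o ctwo ^c m"
  shows "asymmetrizing_number V E =o ctwo ^c |V|"
proof -
  interpret one_ended V E by (unfold_locales) (rule assms(1))
  have "V \<noteq> {}" using assms(1) by (simp add: one_ended_tree_def tree_def)
  then obtain x0 where x0: "x0 \<in> V" by blast
  interpret one_ended_parent V p x0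
    by unfold_locales (auto intro: p_in wf_p x0 p_meet)
  have infinite: "infinite X" if "m \<le>o |X|" for X :: "'a set"
    using cinfinite_mono[OF that assms(3)] by (simp add: cinfinite_def Field_card_of)
  \<comment> \<open>Swapping the two branches is a nontrivial automorphism that moves only vertices
    of their union, so the union has size at least \<open>m\<close>. The branches are in bijection
    and infinite, so \<open>desc y\<close> alone has size at least \<open>m\<close>.\<close>
  have "infinite (desc y) \<and> |{x \<in> V. p x = p y}| \<le>o |Pow (desc y)|"
    if y: "y \<in> V" "z \<in> V" "p y = p z" "y \<noteq> z" "isom f {} {} y z" for y z f
  proof -
    obtain \<phi> where \<phi>: "bij_betw \<phi> V V" "\<forall>u\<in>V. \<phi> (p u) = p (\<phi> u)" "\<phi> y = z"
      "{u \<in> V. \<phi> u \<noteq> u} \<subseteq> desc y \<union> desc z"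
      using swap_siblings[OF y] by blast
    have "automorphism V E \<phi>" using automorphismI[OF \<phi>(1)] \<phi>(2) by blast
    moreover have "y \<in> moved V \<phi>" using y \<phi>(3) by (simp add: moved_def)
    ultimately have "m \<le>o |moved V \<phi>|" using assms(4) unfolding has_motion_def by blast
    moreover have "|moved V \<phi>| \<le>o |desc y \<union> desc z|"
      using \<phi>(4) by (intro card_of_mono1) (simp add: moved_def)
    ultimately have m: "m \<le>o |desc y \<union> desc z|" by (rule ordLeq_transitive)
    have z: "desc z = f ` desc y" using y(5) by (simp add: isom_def bij_betw_def)
    have inf: "infinite (desc y)" using infinite[OF m] by (auto simp: z)
    have "|desc y \<union> desc z| \<le>o |desc y|"
      unfolding z by (rule card_of_Un_absorb[OF inf card_of_image])
    then have "m \<le>o |desc y|" by (rule ordLeq_transitive[OF m])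
    then have "ctwo ^c m \<le>o ctwo ^c |desc y|"
      using assms(2,3) by (intro cexp_mono2_Cnotzero Card_order_ctwo Cinfinite_Cnotzero) auto
    moreover have "ctwo ^c |desc y| =o |Pow (desc y)|"
      unfolding ctwo_def cexp_def Field_card_of by (rule ordIso_symmetric[OF card_of_Pow_Func])
    ultimately have pow: "ctwo ^c m \<le>o |Pow (desc y)|" by (rule ordLeq_ordIso_trans)
    \<comment> \<open>Siblings of \<open>y\<close> are neighbours of \<open>p y\<close>, so there
      are at most \<open>ctwo ^c m\<close> of them, and \<open>desc y\<close> has at least as many
      subsets.\<close>
    have "|{x \<in> V. p x = p y}| \<le>o degree E (p y)"
      unfolding degree_def using p_in y(1) by (intro card_of_mono1) (auto simp: edge_iff)
    also have "degree E (p y) \<le>o max_degree V E"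
      using max_degree_props(2)[of V E] p_in[OF y(1)] by blast
    also note assms(5)
    also note pow
    finally show ?thesis using inf by blast
  qed
  then interpret thin_one_ended_parent V p x0
    by unfold_locales
  obtain S where SV: "\<And>A. S A \<subseteq> V" and S: "\<forall>A B \<phi>. A \<subseteq> V - range spine \<longrightarrow> B \<subseteq> V - range spine \<longrightarrow>
       bij_betw \<phi> V V \<longrightarrow> (\<forall>u\<in>V. \<phi> (p u) = p (\<phi> u)) \<longrightarrow> \<phi> ` S A = S B \<longrightarrow> A = B \<and> (\<forall>v\<in>V. \<phi> v = v)"
    using ex_asymmetrizing_codes by (elim exE conjE) blast
  have S_aut: "A = B \<and> (\<forall>v\<in>V. \<phi> v = v)"
    if "A \<subseteq> V - range spine" "B \<subseteq> V - range spine" "automorphism V E \<phi>" "\<phi> ` S A = S B" for A B \<phi>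
    using S[rule_format, OF that(1,2) _ automorphism_p[OF that(3)] that(4)] that(3)
    by (simp add: automorphism_def)
  let ?W = "V - range spine"
  let ?R = "equivalent_sets V E" and ?A = "asymmetrizing_sets V E"
  have Pow_ctwo: "|Pow V| =o ctwo ^c |V|"
    unfolding ctwo_def cexp_def Field_card_of by (rule card_of_Pow_Func)
  have "asymmetrizing_number V E \<le>o |?A|"
    unfolding asymmetrizing_number_def
    by (rule card_of_mono1[THEN ordLeq_transitive, OF _ card_of_image[of "\<lambda>X. ?R `` {X}"]])
      (auto simp: quotient_def)
  moreover have "|?A| \<le>o |Pow V|" by (rule card_of_mono1) (auto simp: asymmetrizing_sets_def)
  ultimately have upper: "asymmetrizing_number V E \<le>o |Pow V|" by (rule ordLeq_transitive)
  \<comment> \<open>An automorphism attaining the motion moves infinitely many vertices but fixes a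
    tail of the spine, so infinitely many vertices lie off the spine. The spine is countable, hence
    \<open>?W\<close> is as large as \<open>V\<close>.\<close>
  obtain \<psi> where \<psi>: "automorphism V E \<psi>" "|moved V \<psi>| =o m"
    using assms(4) unfolding has_motion_def by blast
  obtain N where N: "\<And>n. n \<ge> N \<Longrightarrow> \<psi> (spine n) = spine n"
    using automorphism_fixes_tail[of \<psi>] \<psi>(1) automorphism_p by (auto simp: automorphism_def)
  have "moved V \<psi> \<subseteq> ?W \<union> spine ` {..<N}"
  proof
    fix v assume v: "v \<in> moved V \<psi>"
    have "n < N" if "v = spine n" for n
      using v N[of n] that by (cases "n < N") (auto simp: moved_def)
    then show "v \<in> ?W \<union> spine ` {..<N}" using v by (auto simp: moved_def)
  qed
  moreover have "infinite (moved V \<psi>)"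
    using infinite[of "moved V \<psi>"] \<psi>(2) ordIso_symmetric ordIso_imp_ordLeq by blast
  ultimately have inf: "infinite ?W"
    by (metis finite_Un finite_imageI finite_lessThan finite_subset)
  have "|range spine| \<le>o |?W|"
    using card_of_image[of spine UNIV] inf unfolding infinite_iff_card_of_nat by (rule ordLeq_transitive)
  then have "|?W \<union> range spine| \<le>o |?W|"
    by (rule card_of_Un_absorb[OF inf])
  moreover have "?W \<union> range spine = V" using spine_in by blast
  ultimately have "|Pow V| \<le>o |Pow ?W|" by (simp add: card_of_Pow_mono)
  moreover have "|Pow ?W| \<le>o asymmetrizing_number V E"
  proof -
    have SA: "S A \<in> ?A" if "A \<in> Pow ?W" for A
      using S_aut[of A A] that SV unfolding asymmetrizing_sets_def by blast
    \<comment> \<open>Equal classes provide an automorphism that maps \<open>S A\<close> to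
      \<open>S B\<close>, which by \<open>S_aut\<close> exists only if \<open>A = B\<close>.\<close>
    have "inj_on (\<lambda>A. ?R `` {S A}) (Pow ?W)"
    proof (rule inj_onI)
      fix A B assume AB: "A \<in> Pow ?W" "B \<in> Pow ?W" "?R `` {S A} = ?R `` {S B}"
      then have "(S A, S B) \<in> ?R"
        using eq_equiv_class[OF AB(3) equiv_equivalent_sets] SA by blast
      then obtain \<phi> where "automorphism V E \<phi>" "\<phi> ` S A = S B"
        by (auto simp: equivalent_sets_def)
      then show "A = B" using S_aut AB by blast
    qed
    moreover have "(\<lambda>A. ?R `` {S A}) ` Pow ?W \<subseteq> ?A // ?R"
      using SA by (auto intro: quotientI)
    ultimately show ?thesis
      unfolding asymmetrizing_number_def card_of_ordLeq[symmetric] by blast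
  qed
  ultimately have "|Pow V| \<le>o asymmetrizing_number V E" by (rule ordLeq_transitive)
  with upper have "asymmetrizing_number V E =o |Pow V|" by (simp add: ordIso_iff_ordLeq)
  then show ?thesis using Pow_ctwo by (rule ordIso_transitive)
qed

end
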